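(* Let $(X,\tau)$ be a $2$-flimsy topological space. Then, $X$ is Hausdorff, and there exists a unique topology $\tau_{\mathrm K}$ on $X$ coarser than $\tau$ such that $(X,\tau_{\mathrm K})$ is a compact $2$-flimsy space. Namely, $\tau_{\mathrm K}$ is the topology generated by the connected components (with respect to $\tau$) of the subsets $X\setminus\{x,y\}$ as $(x,y)$ ranges over all pairs of distinct points of $X$. Furthermore, $(X,\tau)$ and $(X,\tau_{\mathrm K})$ have the same connected subsets and the same open connected subsets.
   Context: The empty set is considered connected. A topological space $X$ is $2$-flimsy if $|X|>2$ and if, for any subset $S\subseteq X$, the set $X\setminus S$ is connected whenever $|S|<2$ and is not connected whenever $|S|=2$. "Compact" means that every open cover has a finite subcover (no Hausdorff assumption). "Coarser" is meant in the non-strict sense ($\tau_{\mathrm K}\subseteq\tau$). The topology generated by a family of subsets is the coarsest topology containing that family. *)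

theory Defs
  imports "HOL-Analysis.Analysis"
begin

text \<open>Cardinality conditions are guarded by finiteness, since \<open>card\<close> of an infinite set is \<open>0\<close>;
  \<open>card S = 2\<close> already implies that \<open>S\<close> is finite. The empty set satisfies \<open>connectedin\<close>.\<close>

definition two_flimsy :: "'a topology \<Rightarrow> bool" where
  "two_flimsy X \<longleftrightarrow>
     (infinite (topspace X) \<or> card (topspace X) > 2) \<and>
     (\<forall>S \<subseteq> topspace X.
        (finite S \<and> card S < 2 \<longrightarrow> connectedin X (topspace X - S)) \<and>
        (card S = 2 \<longrightarrow> \<not> connectedin X (topspace X - S)))"

definition coarser_topology :: "'a topology \<Rightarrow> 'a topology \<Rightarrow> bool" where
  "coarser_topology Y X \<longleftrightarrow>
     topspace Y = topspace X \<and> (\<forall>U. openin Y U \<longrightarrow> openin X U)"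

definition two_point_complement_components :: "'a topology \<Rightarrow> 'a set set" where
  "two_point_complement_components X =
     (\<Union>x \<in> topspace X. \<Union>y \<in> topspace X - {x}.
        connected_components_of (subtopology X (topspace X - {x, y})))"

text \<open>The carrier of \<open>topology_generated_by \<F>\<close> is \<open>\<Union>\<F>\<close>. Inserting \<open>topspace X\<close> makes this
  the coarsest topology on the set \<open>topspace X\<close> that contains the family.\<close>

definition K_topology :: "'a topology \<Rightarrow> 'a topology" where
  "K_topology X =
     topology_generated_by (insert (topspace X) (two_point_complement_components X))"

end

theory Submission
  imports Defs
begin

text \<open>The whole argument rests on one observation (\<open>two_flimsy_connectedin_complement\<close>): in a
  2-flimsy space \<open>X\<close>, the complement of a nonempty connected set \<open>L\<close> is connected. Indeed, if
  \<open>X - L\<close> split into separated nonempty parts \<open>P\<close> and \<open>Q\<close>, then for \<open>p \<in> P\<close> and \<open>q \<in> Q\<close> the sets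
  \<open>L \<union> (P - {p})\<close> and \<open>L \<union> (Q - {q})\<close> would be connected, because \<open>X - {p}\<close> and \<open>X - {q}\<close> are;
  their union \<open>X - {p, q}\<close> would then be connected as well.

  Applied to \<open>L = {x, y}\<close>, this shows that two-point sets are disconnected, so \<open>X\<close> is T1. It also
  shows that \<open>X - {x, y}\<close> is the union of exactly two components, which are open ``arcs'' with end
  points \<open>x\<close> and \<open>y\<close>. If \<open>u\<close> and \<open>v\<close> lie on different arcs between \<open>x\<close> and \<open>y\<close>, then \<open>x\<close> and \<open>y\<close> lie
  on different arcs between \<open>u\<close> and \<open>v\<close> (\<open>arc_pair_separates\<close>); hence \<open>X\<close> is Hausdorff.

  The topology generated by the arcs is coarser than that of \<open>X\<close> and still 2-flimsy, as the arcs
  witness that \<open>X - {x, y}\<close> is disconnected. For compactness it suffices, by Alexander's subbase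
  theorem, to treat a cover by arcs. Pick a member \<open>W\<close> with end points \<open>x\<close>, \<open>y\<close> and a point \<open>t \<in> W\<close>.
  As \<open>X - {t}\<close> is connected, \<open>x\<close> and \<open>y\<close> lie in a connected set \<open>G\<close> that misses \<open>t\<close> and is covered by
  finitely many members. The complement of \<open>G\<close> is connected, misses \<open>x\<close> and \<open>y\<close> and contains \<open>t\<close>, so
  it lies in \<open>W\<close>, and adding \<open>W\<close> gives a finite subcover.

  A coarser 2-flimsy topology on the same set has the same arcs. It therefore refines the topology
  generated by them, and if it is compact, it coincides with this Hausdorff topology. Finally, a set
  \<open>S\<close> that is connected in the coarse topology contains, for any distinct \<open>a, b \<in> S\<close>, one of the two
  arcs between them: otherwise points \<open>u, v \<notin> S\<close> on the two arcs would give a disconnection of \<open>S\<close>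
  by the arcs between \<open>u\<close> and \<open>v\<close>. So \<open>S\<close> is connected in \<open>X\<close>. Around any point of an open connected
  set that is not all of \<open>X\<close> there is an arc inside the set, which is therefore open in the coarse
  topology.\<close>

section \<open>Connected sets and their complements\<close>

text \<open>A connected subset \<open>K\<close> of a connected set \<open>Y\<close>, together with one side of a separation of \<open>Y - K\<close>,
  is connected: a piece split off that does not meet \<open>K\<close> would be split off from \<open>Y\<close> too.\<close>
lemma connectedin_Un_separated_part:
  assumes Y: "connectedin X Y" and K: "connectedin X K" "K \<subseteq> Y"
    and PQ: "Y - K = P \<union> Q" "separatedin X P Q"
  shows "connectedin X (K \<union> P)"
proof -
  have sub: "Y \<subseteq> topspace X"
    using Y connectedin_subset_topspace by blast
  have main: False
    if EF: "E \<union> F = K \<union> P" "E \<noteq> {}" "F \<noteq> {}" "separatedin X E F" "K \<subseteq> E" for E F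
  proof -
    have "E \<inter> F = {}"
      using separatedin_imp_disjoint[OF EF(4)] by (simp add: disjnt_def)
    then have "F \<subseteq> P"
      using EF by blast
    then have "separatedin X F Q"
      using PQ(2) separatedin_mono by blast
    then have "separatedin X (E \<union> Q) F"
      using EF(4) by (simp add: separatedin_sym)
    moreover have "(E \<union> Q) \<union> F = Y"
      using EF(1) PQ(1) K(2) by blast
    ultimately show False
      using Y EF(2,3) unfolding connectedin_eq_not_separated by blast
  qed
  show ?thesis
    unfolding connectedin_eq_not_separated
  proof (intro conjI notI)
    show "K \<union> P \<subseteq> topspace X"
      using sub K(2) PQ(1) by blast
    assume "\<exists>E F. E \<union> F = K \<union> P \<and> E \<noteq> {} \<and> F \<noteq> {} \<and> separatedin X E F"
    then obtain E F where EF: "E \<union> F = K \<union> P" "E \<noteq> {}" "F \<noteq> {}" "separatedin X E F"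
      by blast
    have "K \<subseteq> E \<or> K \<subseteq> F"
      using connectedin_subset_separated_union[OF K(1) EF(4)] EF(1) by blast
    then show False
      using main[of E F] main[of F E] EF by (metis Un_commute separatedin_sym)
  qed
qed

lemma two_flimsy_connectedin_delete:
  assumes "two_flimsy X"
  shows "connectedin X (topspace X - {x})"
proof (cases "x \<in> topspace X")
  case True
  then show ?thesis
    using assms unfolding two_flimsy_def by (auto dest: spec[of _ "{x}"])
next
  case False
  then have "topspace X - {x} = topspace X - {}"
    by blast
  then show ?thesis
    using assms unfolding two_flimsy_def by (metis card.empty empty_subsetI finite.emptyI pos2)
qed

lemma two_flimsy_not_connectedin_delete2:
  assumes "two_flimsy X" "x \<in> topspace X" "y \<in> topspace X" "x \<noteq> y"
  shows "\<not> connectedin X (topspace X - {x, y})"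
proof -
  have "{x, y} \<subseteq> topspace X" "card {x, y} = 2"
    using assms by auto
  then show ?thesis
    using assms(1) unfolding two_flimsy_def by blast
qed

lemma two_flimsy_connectedin_complement:
  assumes X: "two_flimsy X" and L: "connectedin X L" "L \<noteq> {}"
  shows "connectedin X (topspace X - L)"
proof (rule ccontr)
  assume "\<not> connectedin X (topspace X - L)"
  then obtain P Q where PQ: "P \<union> Q = topspace X - L" "P \<noteq> {}" "Q \<noteq> {}" "separatedin X P Q"
    unfolding connectedin_eq_not_separated by blast
  have L_sub: "L \<subseteq> topspace X"
    using L(1) connectedin_subset_topspace by blast
  have disj: "P \<inter> Q = {}"
    using separatedin_imp_disjoint[OF PQ(4)] by (simp add: disjnt_def)
  obtain p q where p: "p \<in> P" and q: "q \<in> Q"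
    using PQ by blast
  have "connectedin X (L \<union> (P - {p}))"
  proof (rule connectedin_Un_separated_part)
    show "topspace X - {p} - L = (P - {p}) \<union> Q"
      using PQ(1) p disj by blast
    show "separatedin X (P - {p}) Q"
      using PQ(4) separatedin_mono by blast
    show "L \<subseteq> topspace X - {p}"
      using L_sub PQ(1) p by blast
  qed (use L(1) two_flimsy_connectedin_delete[OF X] in auto)
  moreover have "connectedin X (L \<union> (Q - {q}))"
  proof (rule connectedin_Un_separated_part)
    show "topspace X - {q} - L = (Q - {q}) \<union> P"
      using PQ(1) q disj by blast
    show "separatedin X (Q - {q}) P"
      using PQ(4) separatedin_mono separatedin_sym by blast
    show "L \<subseteq> topspace X - {q}"
      using L_sub PQ(1) q by blast
  qed (use L(1) two_flimsy_connectedin_delete[OF X] in auto)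
  ultimately have "connectedin X ((L \<union> (P - {p})) \<union> (L \<union> (Q - {q})))"
    by (rule connectedin_Un) (use L(2) in auto)
  moreover have "(L \<union> (P - {p})) \<union> (L \<union> (Q - {q})) = topspace X - {p, q}"
    using PQ(1) p q disj L_sub by blast
  moreover have "p \<in> topspace X" "q \<in> topspace X" "p \<noteq> q"
    using p q PQ(1) disj by blast+
  ultimately show False
    using two_flimsy_not_connectedin_delete2[OF X] by metis
qed

text \<open>If \<open>{x, y}\<close> were connected, so would be its complement.\<close>
lemma two_flimsy_imp_t1_space:
  assumes X: "two_flimsy X"
  shows "t1_space X"
  unfolding t1_space_def
proof (intro ballI impI)
  fix x y
  assume xy: "x \<in> topspace X" "y \<in> topspace X" "x \<noteq> y"
  then have "\<not> connectedin X {x, y}"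
    using two_flimsy_connectedin_complement[OF X, of "{x, y}"]
      two_flimsy_not_connectedin_delete2[OF X] by auto
  then obtain E F where "openin X E" "openin X F" "{x, y} \<subseteq> E \<union> F" "E \<inter> F \<inter> {x, y} = {}"
      "E \<inter> {x, y} \<noteq> {}" "F \<inter> {x, y} \<noteq> {}"
    using xy unfolding connectedin by blast
  then show "\<exists>U. openin X U \<and> x \<in> U \<and> y \<notin> U"
    by (cases "x \<in> E") blast+
qed

section \<open>The two arcs between a pair of points\<close>

text \<open>\<open>arc_pair X x y U V\<close>: the sets \<open>U\<close> and \<open>V\<close> are the two open arcs between the distinct points \<open>x\<close>
  and \<open>y\<close>, that is, \<open>X - {x, y}\<close> is the disjoint union of the nonempty open connected sets \<open>U\<close> and
  \<open>V\<close>. The arcs do not contain their end points.\<close>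
definition arc_pair :: "'a topology \<Rightarrow> 'a \<Rightarrow> 'a \<Rightarrow> 'a set \<Rightarrow> 'a set \<Rightarrow> bool" where
  "arc_pair X x y U V \<longleftrightarrow>
     x \<in> topspace X \<and> y \<in> topspace X \<and> x \<noteq> y \<and>
     U \<noteq> {} \<and> V \<noteq> {} \<and> U \<inter> V = {} \<and> U \<union> V = topspace X - {x, y} \<and>
     openin X U \<and> openin X V \<and> connectedin X U \<and> connectedin X V"

lemma arc_pair_swap: "arc_pair X x y U V \<Longrightarrow> arc_pair X x y V U"
  by (auto simp: arc_pair_def)

lemma arc_pair_swap_ends: "arc_pair X x y U V \<Longrightarrow> arc_pair X y x U V"
  by (auto simp: arc_pair_def)

lemma arc_pair_subset_cases:
  assumes "arc_pair X x y U V" "connectedin X C" "x \<notin> C" "y \<notin> C"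
  shows "C \<subseteq> U \<or> C \<subseteq> V"
proof (rule connectedin_subset_separated_union)
  show "separatedin X U V"
    using assms(1) by (simp add: arc_pair_def separatedin_open_sets disjnt_def)
  show "C \<subseteq> U \<union> V"
    using assms connectedin_subset_topspace[OF assms(2)] by (auto simp: arc_pair_def)
qed (fact assms)

text \<open>Any separation \<open>P \<union> Q\<close> of \<open>X - {x, y}\<close> does: \<open>{x, y} \<union> Q\<close> is connected, so its complement \<open>P\<close> is
  connected, and likewise \<open>Q\<close>.\<close>
lemma two_flimsy_arc_pair_exists:
  assumes X: "two_flimsy X" and xy: "x \<in> topspace X" "y \<in> topspace X" "x \<noteq> y"
  obtains U V where "arc_pair X x y U V"
proof -
  obtain P Q where PQ: "P \<union> Q = topspace X - {x, y}" "P \<noteq> {}" "Q \<noteq> {}" "separatedin X P Q"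
    using two_flimsy_not_connectedin_delete2[OF X xy]
    unfolding connectedin_eq_not_separated by blast
  have disj: "P \<inter> Q = {}"
    using separatedin_imp_disjoint[OF PQ(4)] by (simp add: disjnt_def)
  have "closedin X {x, y}"
    using two_flimsy_imp_t1_space[OF X] xy by (simp add: t1_space_closedin_finite)
  then have "openin X (P \<union> Q)"
    using PQ(1) by (simp add: openin_diff)
  then have opens: "openin X P" "openin X Q"
    using PQ(4) by (auto simp: separation_openin_Un_gen openin_open_subtopology)
  have side: "connectedin X ({a} \<union> R)"
    if "R \<union> S = topspace X - {x, y}" "R \<inter> S = {}" "separatedin X R S" "{a, b} = {x, y}" "a \<noteq> b"
    for R S a b
  proof (rule connectedin_Un_separated_part)
    show "connectedin X (topspace X - {b})"
      using two_flimsy_connectedin_delete[OF X] .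
    show "topspace X - {b} - {a} = R \<union> S"
      using that by blast
    show "connectedin X {a}" "{a} \<subseteq> topspace X - {b}"
      using that xy by auto
  qed (fact that)
  have conn: "connectedin X R"
    if RS: "R \<union> S = topspace X - {x, y}" "R \<inter> S = {}" "separatedin X S R" "S \<noteq> {}" for R S
  proof -
    have "connectedin X ({x} \<union> S)" "connectedin X ({y} \<union> S)"
      using side[of S R x y] side[of S R y x] RS xy by (auto simp: Un_commute)
    then have "connectedin X (({x} \<union> S) \<union> ({y} \<union> S))"
      by (rule connectedin_Un) (use RS(4) in auto)
    then have "connectedin X (topspace X - (({x} \<union> S) \<union> ({y} \<union> S)))"
      by (rule two_flimsy_connectedin_complement[OF X]) auto
    moreover have "topspace X - (({x} \<union> S) \<union> ({y} \<union> S)) = R"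
      using RS(1,2) by blast
    ultimately show ?thesis
      by simp
  qed
  have "connectedin X P" "connectedin X Q"
    using conn[of P Q] conn[of Q P] PQ disj by (auto simp: separatedin_sym)
  then have "arc_pair X x y P Q"
    using xy PQ disj opens by (simp add: arc_pair_def)
  then show thesis
    by (rule that)
qed

lemma arc_pair_containing_point:
  assumes X: "two_flimsy X" and xy: "x \<in> topspace X" "y \<in> topspace X" "x \<noteq> y"
    and z: "z \<in> topspace X" "z \<noteq> x" "z \<noteq> y"
  obtains U V where "arc_pair X x y U V" "z \<in> U"
proof -
  obtain U V where UV: "arc_pair X x y U V"
    using two_flimsy_arc_pair_exists[OF X xy] .
  then have "z \<in> U \<union> V"
    using z by (auto simp: arc_pair_def)
  then show thesis
    using that UV arc_pair_swap[OF UV] by blast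
qed

lemma arc_pair_connectedin_insert:
  assumes X: "two_flimsy X" and UV: "arc_pair X x y U V"
  shows "connectedin X (insert x U)"
proof -
  have "connectedin X ({x} \<union> U)"
  proof (rule connectedin_Un_separated_part)
    show "connectedin X (topspace X - {y})"
      using two_flimsy_connectedin_delete[OF X] .
    show "topspace X - {y} - {x} = U \<union> V"
      using UV by (auto simp: arc_pair_def)
    show "separatedin X U V"
      using UV by (simp add: arc_pair_def separatedin_open_sets disjnt_def)
  qed (use UV in \<open>auto simp: arc_pair_def\<close>)
  then show ?thesis
    by simp
qed

text \<open>If \<open>x\<close> and \<open>y\<close> were both outside \<open>B\<close>, the connected sets \<open>B \<union> {u}\<close> and \<open>B \<union> {v}\<close> would avoid \<open>x\<close> and
  \<open>y\<close>, hence lie in \<open>U\<close> and in \<open>V\<close> respectively, although these are disjoint.\<close>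
lemma arc_pair_interlace:
  assumes X: "two_flimsy X" and UV: "arc_pair X x y U V" and AB: "arc_pair X u v A B"
    and u: "u \<in> U" and v: "v \<in> V" and x: "x \<in> A"
  shows "y \<in> B"
proof (rule ccontr)
  assume "y \<notin> B"
  have xB: "x \<notin> B"
    using x AB by (auto simp: arc_pair_def)
  have ends: "x \<notin> U" "y \<notin> U" "x \<notin> V" "y \<notin> V" "U \<inter> V = {}"
    using UV by (auto simp: arc_pair_def)
  have "connectedin X (insert u B)" "connectedin X (insert v B)"
    using arc_pair_connectedin_insert[OF X] AB arc_pair_swap arc_pair_swap_ends by metis+
  then have "insert u B \<subseteq> U \<or> insert u B \<subseteq> V" "insert v B \<subseteq> U \<or> insert v B \<subseteq> V"
    using arc_pair_subset_cases[OF UV] u v ends xB \<open>y \<notin> B\<close> by (metis insertE)+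
  then have "B = {}"
    using u v ends by blast
  then show False
    using AB by (simp add: arc_pair_def)
qed

text \<open>Separation of pairs of points is symmetric: if \<open>x\<close> and \<open>y\<close> separate \<open>u\<close> from \<open>v\<close>, then \<open>u\<close> and \<open>v\<close>
  separate \<open>x\<close> from \<open>y\<close>.\<close>
lemma arc_pair_separates:
  assumes X: "two_flimsy X" and UV: "arc_pair X x y U V" and u: "u \<in> U" and v: "v \<in> V"
  obtains A B where "arc_pair X u v A B" "x \<in> A" "y \<in> B"
proof -
  have "u \<in> topspace X" "v \<in> topspace X" "u \<noteq> v" "x \<in> topspace X" "x \<noteq> u" "x \<noteq> v"
    using UV u v by (auto simp: arc_pair_def)
  then obtain A B where AB: "arc_pair X u v A B" "x \<in> A"
    using arc_pair_containing_point[OF X] by metis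
  then show thesis
    using that arc_pair_interlace[OF X UV AB(1) u v AB(2)] by blast
qed

lemma two_flimsy_imp_Hausdorff_space:
  assumes X: "two_flimsy X"
  shows "Hausdorff_space X"
  unfolding Hausdorff_space_def
proof (intro allI impI)
  fix x y
  assume "x \<in> topspace X \<and> y \<in> topspace X \<and> x \<noteq> y"
  then obtain U V where UV: "arc_pair X x y U V"
    using two_flimsy_arc_pair_exists[OF X] by blast
  then obtain u v where "u \<in> U" "v \<in> V"
    by (auto simp: arc_pair_def)
  then obtain A B where "arc_pair X u v A B" "x \<in> A" "y \<in> B"
    using arc_pair_separates[OF X UV] by blast
  then show "\<exists>U V. openin X U \<and> openin X V \<and> x \<in> U \<and> y \<in> V \<and> disjnt U V"
    by (auto simp: arc_pair_def disjnt_def)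
qed

section \<open>The topology generated by the arcs\<close>

lemma connected_components_of_arc_pair:
  assumes UV: "arc_pair X x y U V"
  shows "connected_components_of (subtopology X (topspace X - {x, y})) = {U, V}"
proof -
  let ?Z = "subtopology X (topspace X - {x, y})"
  have conn: "connectedin ?Z U" "connectedin ?Z V"
    using UV by (auto simp: arc_pair_def connectedin_subtopology)
  have cases: "C = U \<or> C = V" if C: "C \<in> connected_components_of ?Z" for C
  proof -
    have "connectedin X C" "x \<notin> C" "y \<notin> C"
      using connectedin_connected_components_of[OF C] by (auto simp: connectedin_subtopology)
    then have "C \<subseteq> U \<or> C \<subseteq> V"
      using arc_pair_subset_cases[OF UV] by blast
    moreover have "C \<noteq> {}"
      using nonempty_connected_components_of[OF C] .
    ultimately show ?thesis
      using connected_components_of_maximal[OF C] conn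
      by (metis Int_absorb1 Int_absorb2 disjnt_def subset_antisym)
  qed
  have union: "\<Union> (connected_components_of ?Z) = U \<union> V"
    using UV by (auto simp: Union_connected_components_of arc_pair_def)
  have ne: "U \<noteq> {}" "V \<noteq> {}" "U \<inter> V = {}"
    using UV by (auto simp: arc_pair_def)
  have "U \<in> connected_components_of ?Z" "V \<in> connected_components_of ?Z"
    using union ne cases by blast+
  then show ?thesis
    using cases by blast
qed

lemma two_point_complement_components_eq:
  assumes X: "two_flimsy X"
  shows "two_point_complement_components X = {U. \<exists>x y V. arc_pair X x y U V}"
proof (intro set_eqI iffI)
  fix U
  assume "U \<in> two_point_complement_components X"
  then obtain x y where xy: "x \<in> topspace X" "y \<in> topspace X" "x \<noteq> y"
    and U: "U \<in> connected_components_of (subtopology X (topspace X - {x, y}))"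
    unfolding two_point_complement_components_def by blast
  obtain P Q where PQ: "arc_pair X x y P Q"
    using two_flimsy_arc_pair_exists[OF X xy] .
  then have "U = P \<or> U = Q"
    using U connected_components_of_arc_pair[OF PQ] by simp
  then show "U \<in> {U. \<exists>x y V. arc_pair X x y U V}"
    using PQ arc_pair_swap[OF PQ] by blast
next
  fix U
  assume "U \<in> {U. \<exists>x y V. arc_pair X x y U V}"
  then obtain x y V where UV: "arc_pair X x y U V"
    by blast
  then have "U \<in> connected_components_of (subtopology X (topspace X - {x, y}))"
    using connected_components_of_arc_pair[OF UV] by simp
  moreover have "x \<in> topspace X" "y \<in> topspace X - {x}"
    using UV by (auto simp: arc_pair_def)
  ultimately show "U \<in> two_point_complement_components X"
    unfolding two_point_complement_components_def by blast
qed

lemma topspace_K_topology [simp]: "topspace (K_topology X) = topspace X"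
proof -
  have "U \<subseteq> topspace X" if "U \<in> two_point_complement_components X" for U
    using that connected_components_of_subset
    unfolding two_point_complement_components_def by fastforce
  then show ?thesis
    unfolding K_topology_def by auto
qed

lemma openin_K_topology_arc:
  assumes "two_flimsy X" "arc_pair X x y U V"
  shows "openin (K_topology X) U"
proof -
  have "U \<in> insert (topspace X) (two_point_complement_components X)"
    unfolding two_point_complement_components_eq[OF assms(1)] using assms(2) by blast
  then show ?thesis
    unfolding K_topology_def by (rule topology_generated_by_Basis)
qed

lemma K_topology_coarsest:
  assumes X: "two_flimsy X" and top: "topspace Y = topspace X"
    and arcs: "\<And>x y U V. arc_pair X x y U V \<Longrightarrow> openin Y U"
    and U: "openin (K_topology X) U"
  shows "openin Y U"
proof (rule generate_topology_on_coarsest)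
  show "generate_topology_on (insert (topspace X) (two_point_complement_components X)) U"
    using U unfolding K_topology_def by (rule openin_topology_generated_by)
  fix S
  assume S: "S \<in> insert (topspace X) (two_point_complement_components X)"
  show "openin Y S"
  proof (cases "S = topspace X")
    case True
    then show ?thesis
      using openin_topspace[of Y] top by simp
  next
    case False
    then show ?thesis
      using S arcs unfolding two_point_complement_components_eq[OF X] by blast
  qed
qed simp

lemma coarser_K_topology:
  assumes "two_flimsy X"
  shows "coarser_topology (K_topology X) X"
  unfolding coarser_topology_def
proof (intro conjI allI impI)
  show "openin X U" if "openin (K_topology X) U" for U
    by (rule K_topology_coarsest[OF assms refl _ that]) (simp add: arc_pair_def)
qed simp

lemma coarser_topology_connectedin:
  assumes "coarser_topology Y X" "connectedin X S"
  shows "connectedin Y S"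
proof -
  have "continuous_map X Y id"
    using assms(1) topology_finer_continuous_id[of Y X] by (simp add: coarser_topology_def)
  then show ?thesis
    using connectedin_continuous_map_image[of X Y id S] assms(2) by simp
qed

lemma two_flimsy_K_topology:
  assumes X: "two_flimsy X"
  shows "two_flimsy (K_topology X)"
  unfolding two_flimsy_def
proof (intro conjI allI impI)
  show "infinite (topspace (K_topology X)) \<or> 2 < card (topspace (K_topology X))"
    using X by (simp add: two_flimsy_def)
  fix S
  assume S: "S \<subseteq> topspace (K_topology X)"
  show "connectedin (K_topology X) (topspace (K_topology X) - S)" if "finite S \<and> card S < 2"
    using X S that coarser_topology_connectedin[OF coarser_K_topology[OF X]]
    by (simp add: two_flimsy_def)
  show "\<not> connectedin (K_topology X) (topspace (K_topology X) - S)" if "card S = 2"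
  proof -
    obtain x y where xy: "S = {x, y}" "x \<noteq> y"
      using \<open>card S = 2\<close> by (meson card_2_iff)
    then obtain U V where UV: "arc_pair X x y U V"
      using two_flimsy_arc_pair_exists[OF X] S by (metis insert_subset topspace_K_topology)
    have "openin (K_topology X) U" "openin (K_topology X) V"
      using openin_K_topology_arc[OF X] UV arc_pair_swap by metis+
    then show ?thesis
      using UV connectedinD[of "K_topology X" "topspace X - S" U V] xy
      by (auto simp: arc_pair_def)
  qed
qed

section \<open>Compactness\<close>

text \<open>An arc minus a point \<open>t\<close> contains an open connected neighbourhood of each of its points \<open>s\<close>. This
  replaces local connectedness of \<open>X\<close>, which may fail. If \<open>t \<in> W\<close>, one of the
  arcs containing \<open>s\<close> between \<open>a\<close> and \<open>t\<close> or between \<open>b\<close> and \<open>t\<close> will do.\<close>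
lemma arc_avoid_point:
  assumes X: "two_flimsy X" and WV: "arc_pair X a b W V" and s: "s \<in> W"
    and t: "t \<in> topspace X" "t \<noteq> s"
  obtains N where "openin X N" "connectedin X N" "s \<in> N" "N \<subseteq> W" "t \<notin> N"
proof (cases "t \<in> W")
  case False
  then show thesis
    using that[of W] WV s by (auto simp: arc_pair_def)
next
  case True
  have abVW: "a \<in> topspace X" "b \<in> topspace X" "a \<noteq> b" "a \<notin> W" "b \<notin> W" "a \<notin> V" "b \<notin> V"
      "V \<noteq> {}" "W \<inter> V = {}" "W \<union> V = topspace X - {a, b}"
    using WV by (auto simp: arc_pair_def)
  have W_eq: "W = topspace X - insert a (insert b V)"
    using WV by (auto simp: arc_pair_def)
  have sX: "s \<in> topspace X" "s \<noteq> a" "s \<noteq> b" "t \<noteq> a" "t \<noteq> b" "t \<notin> V"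
    using s True abVW by auto
  obtain P M where PM: "arc_pair X a t P M" and sP: "s \<in> P"
    using arc_pair_containing_point[OF X abVW(1) t(1) _ sX(1)] sX t(2) by metis
  obtain Q M' where QM: "arc_pair X b t Q M'" and sQ: "s \<in> Q"
    using arc_pair_containing_point[OF X abVW(2) t(1) _ sX(1)] sX t(2) by metis
  have connV: "connectedin X (insert a V)" "connectedin X (insert b V)"
    using arc_pair_connectedin_insert[OF X] WV arc_pair_swap arc_pair_swap_ends by metis+
  have PM': "insert b V \<subseteq> P \<or> insert b V \<subseteq> M"
    using arc_pair_subset_cases[OF PM connV(2)] abVW sX by auto
  have QM': "insert a V \<subseteq> Q \<or> insert a V \<subseteq> M'"
    using arc_pair_subset_cases[OF QM connV(1)] abVW sX by auto
  have P_props: "openin X P" "connectedin X P" "t \<notin> P" "P \<inter> M = {}" "a \<notin> P" "P \<subseteq> topspace X"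
    using PM by (auto simp: arc_pair_def)
  have Q_props: "openin X Q" "connectedin X Q" "t \<notin> Q" "Q \<inter> M' = {}" "b \<notin> Q" "Q \<subseteq> topspace X"
    using QM by (auto simp: arc_pair_def)
  consider "insert b V \<subseteq> M" | "insert a V \<subseteq> M'" | "insert b V \<subseteq> P" "insert a V \<subseteq> Q"
    using PM' QM' by blast
  then show thesis
  proof cases
    case 1
    then have "P \<subseteq> topspace X - insert a (insert b V)"
      using P_props(4-6) by blast
    then have "P \<subseteq> W"
      using W_eq by simp
    then show thesis
      using that[of P] P_props sP by blast
  next
    case 2
    then have "Q \<subseteq> topspace X - insert a (insert b V)"
      using Q_props(4-6) by blast
    then have "Q \<subseteq> W"
      using W_eq by simp
    then show thesis
      using that[of Q] Q_props sQ by blast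
  next
    case 3
    \<comment> \<open>Both arcs would leave \<open>W\<close>. Their complements are connected and share \<open>t\<close>, so \<open>P \<inter> Q\<close> is
      connected; but it meets both \<open>W\<close> (in \<open>s\<close>) and \<open>V\<close>, and contains neither \<open>a\<close> nor \<open>b\<close>.\<close>
    have t_comp: "t \<in> topspace X - P" "t \<in> topspace X - Q"
      using t P_props Q_props by auto
    have "connectedin X ((topspace X - P) \<union> (topspace X - Q))"
    proof (rule connectedin_Un)
      show "connectedin X (topspace X - P)" "connectedin X (topspace X - Q)"
        using two_flimsy_connectedin_complement[OF X] P_props(2) Q_props(2) sP sQ by blast+
    qed (use t_comp in blast)
    then have "connectedin X (topspace X - ((topspace X - P) \<union> (topspace X - Q)))"
      by (rule two_flimsy_connectedin_complement[OF X]) (use t_comp in blast)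
    moreover have "topspace X - ((topspace X - P) \<union> (topspace X - Q)) = P \<inter> Q"
      using P_props by blast
    ultimately have "connectedin X (P \<inter> Q)"
      by simp
    then have "P \<inter> Q \<subseteq> W \<or> P \<inter> Q \<subseteq> V"
      using arc_pair_subset_cases[OF WV] P_props Q_props by blast
    then have False
      using s sP sQ abVW 3 by blast
    then show thesis ..
  qed
qed

text \<open>The points that can be joined to \<open>x\<close> by a connected set \<open>G\<close> missing \<open>t\<close> and covered by finitely many
  members of \<open>\<C>\<close> form a subset \<open>R\<close> of \<open>X - {t}\<close> that is open and closed in \<open>X - {t}\<close>.\<close>
lemma connected_chain_avoiding_point:
  assumes X: "two_flimsy X" and t: "t \<in> topspace X"
    and \<C>: "\<And>W. W \<in> \<C> \<Longrightarrow> \<exists>a b V. arc_pair X a b W V" "topspace X \<subseteq> \<Union>\<C>"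
    and x: "x \<in> topspace X" "x \<noteq> t" and y: "y \<in> topspace X" "y \<noteq> t"
  obtains G \<G> where "finite \<G>" "\<G> \<subseteq> \<C>" "G \<subseteq> \<Union>\<G>" "connectedin X G" "t \<notin> G" "x \<in> G" "y \<in> G"
proof -
  define R where "R = {z. \<exists>G \<G>. finite \<G> \<and> \<G> \<subseteq> \<C> \<and> G \<subseteq> \<Union>\<G> \<and> connectedin X G \<and> t \<notin> G \<and> x \<in> G \<and> z \<in> G}"
  have nbhd: "\<exists>N W. openin X N \<and> connectedin X N \<and> z \<in> N \<and> N \<subseteq> W \<and> W \<in> \<C> \<and> t \<notin> N"
    if z: "z \<in> topspace X" "z \<noteq> t" for z
  proof -
    obtain W a b V where "W \<in> \<C>" "z \<in> W" "arc_pair X a b W V"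
      using \<C> z by (meson UnionE subsetD)
    then show ?thesis
      using arc_avoid_point[OF X, of a b W V z t] t z by metis
  qed
  have extend: "N \<subseteq> R"
    if N: "connectedin X N" "N \<subseteq> W" "W \<in> \<C>" "t \<notin> N" "z \<in> N" "z \<in> R" for N W z
  proof
    fix w
    assume "w \<in> N"
    obtain G \<G> where G: "finite \<G>" "\<G> \<subseteq> \<C>" "G \<subseteq> \<Union>\<G>" "connectedin X G" "t \<notin> G" "x \<in> G" "z \<in> G"
      using N(6) by (auto simp: R_def)
    have "connectedin X (G \<union> N)"
      using G N by (intro connectedin_Un) auto
    then have "finite (insert W \<G>) \<and> insert W \<G> \<subseteq> \<C> \<and> G \<union> N \<subseteq> \<Union>(insert W \<G>) \<and> connectedin X (G \<union> N)
        \<and> t \<notin> G \<union> N \<and> x \<in> G \<union> N \<and> w \<in> G \<union> N"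
      using G N \<open>w \<in> N\<close> by auto
    then show "w \<in> R"
      unfolding R_def by blast
  qed
  have R_sub: "R \<subseteq> topspace X - {t}"
    using connectedin_subset_topspace by (fastforce simp: R_def)
  have "x \<in> R"
  proof -
    obtain N W where N: "connectedin X N" "x \<in> N" "N \<subseteq> W" "W \<in> \<C>" "t \<notin> N"
      using nbhd[OF x] by blast
    then have "finite {W} \<and> {W} \<subseteq> \<C> \<and> N \<subseteq> \<Union>{W} \<and> connectedin X N \<and> t \<notin> N \<and> x \<in> N \<and> x \<in> N"
      by auto
    then show ?thesis
      unfolding R_def by blast
  qed
  have "openin X R"
  proof (subst openin_subopen, intro ballI)
    fix z
    assume "z \<in> R"
    then show "\<exists>T. openin X T \<and> z \<in> T \<and> T \<subseteq> R"
      using nbhd[of z] extend[of _ _ z] R_sub by blast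
  qed
  moreover have "openin X (topspace X - {t} - R)"
  proof (subst openin_subopen, intro ballI)
    fix z
    assume z: "z \<in> topspace X - {t} - R"
    then obtain N W where N: "openin X N" "connectedin X N" "z \<in> N" "N \<subseteq> W" "W \<in> \<C>" "t \<notin> N"
      using nbhd[of z] by auto
    have "N \<inter> R = {}"
      using extend[OF N(2,4,5,6)] N(3) z by blast
    then have "N \<subseteq> topspace X - {t} - R"
      using N openin_subset by blast
    then show "\<exists>T. openin X T \<and> z \<in> T \<and> T \<subseteq> topspace X - {t} - R"
      using N by blast
  qed
  ultimately have "topspace X - {t} - R = {}"
    using connectedinD[OF two_flimsy_connectedin_delete[OF X, of t], of R "topspace X - {t} - R"]
      \<open>x \<in> R\<close> R_sub by blast
  then have "y \<in> R"
    using y by blast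
  then show thesis
    using that unfolding R_def by blast
qed

lemma arc_cover_has_finite_subcover:
  assumes X: "two_flimsy X"
    and \<C>: "\<And>W. W \<in> \<C> \<Longrightarrow> \<exists>a b V. arc_pair X a b W V" "topspace X \<subseteq> \<Union>\<C>"
  obtains \<D> where "finite \<D>" "\<D> \<subseteq> \<C>" "topspace X \<subseteq> \<Union>\<D>"
proof -
  have "topspace X \<noteq> {}"
    using X by (auto simp: two_flimsy_def)
  then obtain W where "W \<in> \<C>"
    using \<C>(2) by blast
  then obtain x y V where WV: "arc_pair X x y W V"
    using \<C>(1) by blast
  then obtain t where t: "t \<in> W"
    by (auto simp: arc_pair_def)
  have xyt: "t \<in> topspace X" "x \<in> topspace X" "x \<noteq> t" "y \<in> topspace X" "y \<noteq> t"
    using WV t by (auto simp: arc_pair_def)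
  obtain G \<G> where G: "finite \<G>" "\<G> \<subseteq> \<C>" "G \<subseteq> \<Union>\<G>" "connectedin X G" "t \<notin> G" "x \<in> G" "y \<in> G"
    using connected_chain_avoiding_point[OF X xyt(1) \<C> xyt(2-5)] .
  have "connectedin X (topspace X - G)"
    using two_flimsy_connectedin_complement[OF X G(4)] G(6) by blast
  then have "topspace X - G \<subseteq> W \<or> topspace X - G \<subseteq> V"
    using arc_pair_subset_cases[OF WV] G(6,7) by blast
  then have "topspace X - G \<subseteq> W"
    using t G(5) xyt(1) WV by (auto simp: arc_pair_def)
  then have "topspace X \<subseteq> \<Union>(insert W \<G>)"
    using G(3) by blast
  then show thesis
    using that[of "insert W \<G>"] G \<open>W \<in> \<C>\<close> by auto
qed

lemma compact_space_K_topology: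
  assumes X: "two_flimsy X"
  shows "compact_space (K_topology X)"
proof (rule Alexander_subbase_alt)
  let ?\<B> = "insert (topspace X) (two_point_complement_components X)"
  let ?Z = "topology (arbitrary union_of (finite intersection_of (\<lambda>S. S \<in> ?\<B>) relative_to topspace X))"
  show "topspace X \<subseteq> \<Union>?\<B>"
    by blast
  show "\<exists>\<D>. finite \<D> \<and> \<D> \<subseteq> \<C> \<and> topspace X \<subseteq> \<Union>\<D>"
    if \<C>: "\<C> \<subseteq> ?\<B>" "topspace X \<subseteq> \<Union>\<C>" for \<C>
  proof (cases "topspace X \<in> \<C>")
    case True
    then show ?thesis
      by (intro exI[of _ "{topspace X}"]) auto
  next
    case False
    then have "\<And>W. W \<in> \<C> \<Longrightarrow> \<exists>a b V. arc_pair X a b W V"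
      using \<C>(1) two_point_complement_components_eq[OF X] by auto
    then show ?thesis
      using arc_cover_has_finite_subcover[OF X _ \<C>(2)] by metis
  qed
  \<comment> \<open>The topology generated by the family agrees with the form used in Alexander's theorem.\<close>
  have K_le: "openin ?Z U" if "openin (K_topology X) U" for U
  proof (rule K_topology_coarsest[OF X _ _ that])
    show "topspace ?Z = topspace X"
      by (rule topspace_subbase)
    fix x y U V
    assume UV: "arc_pair X x y U V"
    then have "U \<in> ?\<B>"
      unfolding two_point_complement_components_eq[OF X] by blast
    moreover have "U \<subseteq> topspace X"
      using UV by (auto simp: arc_pair_def)
    ultimately have "((\<lambda>S. S \<in> ?\<B>) relative_to topspace X) U"
      unfolding relative_to_def by blast
    then have "(finite intersection_of (\<lambda>S. S \<in> ?\<B>) relative_to topspace X) U"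
      by (metis (mono_tags, lifting) finite_intersection_of_inc relative_to_def)
    then show "openin ?Z U"
      unfolding openin_subbase by (rule arbitrary_union_of_inc)
  qed
  have Z_le: "openin (K_topology X) U" if "openin ?Z U" for U
  proof (rule minimal_topology_subbase[OF _ _ that])
    show top: "openin (K_topology X) (topspace X)"
      using openin_topspace[of "K_topology X"] by simp
    show "openin (K_topology X) S" if "S \<in> ?\<B>" for S
      using that top openin_K_topology_arc[OF X]
      unfolding two_point_complement_components_eq[OF X] by blast
  qed
  show "?Z = K_topology X"
    using K_le Z_le by (auto simp: topology_eq)
qed

section \<open>Uniqueness\<close>

text \<open>The arcs between \<open>x\<close> and \<open>y\<close> for \<open>X\<close> are connected for the coarser topology, so each lies in an arc
  for \<open>Y\<close>; as both pairs partition \<open>X - {x, y}\<close>, they coincide.\<close>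
lemma coarser_two_flimsy_openin_arc:
  assumes Y: "two_flimsy Y" "coarser_topology Y X" and UV: "arc_pair X x y U V"
  shows "openin Y U"
proof -
  have top: "topspace Y = topspace X"
    using Y(2) by (simp add: coarser_topology_def)
  obtain A B where AB: "arc_pair Y x y A B"
    using two_flimsy_arc_pair_exists[OF Y(1)] UV top by (metis arc_pair_def)
  have UV': "x \<notin> U" "y \<notin> U" "x \<notin> V" "y \<notin> V" "U \<noteq> {}" "V \<noteq> {}" "U \<union> V = A \<union> B" "A \<inter> B = {}"
     "A \<noteq> {}" "B \<noteq> {}" "openin Y A" "openin Y B" "connectedin X U" "connectedin X V" "U \<inter> V = {}"
    using UV AB top by (auto simp: arc_pair_def)
  then have "U \<subseteq> A \<or> U \<subseteq> B" "V \<subseteq> A \<or> V \<subseteq> B"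
    using arc_pair_subset_cases[OF AB] coarser_topology_connectedin[OF Y(2)] by metis+
  then have "U = A \<or> U = B"
    using UV' by blast
  then show ?thesis
    using UV' by blast
qed

lemma compact_two_flimsy_coarsening_unique:
  assumes X: "two_flimsy X" and Y: "coarser_topology Y X" "compact_space Y" "two_flimsy Y"
  shows "Y = K_topology X"
proof (rule compact_Hausdorff_space_optimal)
  have top: "topspace Y = topspace X"
    using Y(1) by (simp add: coarser_topology_def)
  then show "topspace Y = topspace (K_topology X)"
    by simp
  show "openin Y U" if "openin (K_topology X) U" for U
    using K_topology_coarsest[OF X top _ that] coarser_two_flimsy_openin_arc[OF Y(3,1)] by blast
  show "Hausdorff_space (K_topology X)"
    using two_flimsy_imp_Hausdorff_space[OF two_flimsy_K_topology[OF X]] .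
qed (fact Y)

section \<open>Connected sets and open connected sets\<close>

lemma connectedin_K_topology_imp:
  assumes X: "two_flimsy X" and S: "connectedin (K_topology X) S"
  shows "connectedin X S"
proof (cases "S = {}")
  case False
  then obtain a where a: "a \<in> S"
    by blast
  have S_sub: "S \<subseteq> topspace X"
    using connectedin_subset_topspace[OF S] by simp
  have join: "\<exists>T. connectedin X T \<and> a \<in> T \<and> b \<in> T \<and> T \<subseteq> S" if b: "b \<in> S" for b
  proof (cases "a = b")
    case True
    then show ?thesis
      using a S_sub by (intro exI[of _ "{a}"]) auto
  next
    case False
    then obtain U V where UV: "arc_pair X a b U V"
      using two_flimsy_arc_pair_exists[OF X] a b S_sub by blast
    have "U \<subseteq> S \<or> V \<subseteq> S"
    proof (rule ccontr)
      assume "\<not> (U \<subseteq> S \<or> V \<subseteq> S)"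
      then obtain u v where uv: "u \<in> U" "u \<notin> S" "v \<in> V" "v \<notin> S"
        by blast
      obtain A B where AB: "arc_pair X u v A B" "a \<in> A" "b \<in> B"
        using arc_pair_separates[OF X UV uv(1,3)] .
      have "openin (K_topology X) A" "openin (K_topology X) B"
        using openin_K_topology_arc[OF X] AB(1) arc_pair_swap by metis+
      moreover have "S \<subseteq> A \<union> B" "A \<inter> B \<inter> S = {}"
        using AB(1) uv S_sub by (auto simp: arc_pair_def)
      ultimately show False
        using connectedinD[OF S] AB a b by blast
    qed
    then obtain P Q where PQ: "arc_pair X a b P Q" "P \<subseteq> S"
      using UV arc_pair_swap by metis
    have "connectedin X (insert a P)" "connectedin X (insert b P)"
      using arc_pair_connectedin_insert[OF X] PQ(1) arc_pair_swap_ends by metis+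
    then have "connectedin X (insert a P \<union> insert b P)"
      by (rule connectedin_Un) (use PQ(1) in \<open>auto simp: arc_pair_def\<close>)
    then show ?thesis
      using PQ(2) a b by (intro exI[of _ "insert a P \<union> insert b P"]) auto
  qed
  let ?\<T> = "{T. connectedin X T \<and> a \<in> T \<and> T \<subseteq> S}"
  have "connectedin X (\<Union>?\<T>)"
    using join[OF a] by (intro connectedin_Union) auto
  moreover have "\<Union>?\<T> = S"
    using join by blast
  ultimately show ?thesis
    by simp
qed simp

text \<open>For \<open>u \<in> U\<close> and \<open>c \<notin> U\<close>, the set \<open>U\<close> meets both arcs between \<open>u\<close> and \<open>c\<close>, in \<open>p\<close> and \<open>q\<close> say. The arc
  between \<open>p\<close> and \<open>q\<close> that contains \<open>u\<close> lies in \<open>U\<close>, because the connected complement of \<open>U\<close> lies in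
  the other one.\<close>
lemma openin_connectedin_imp_openin_K_topology:
  assumes X: "two_flimsy X" and U: "openin X U" "connectedin X U"
  shows "openin (K_topology X) U"
proof (cases "U = topspace X")
  case True
  then show ?thesis
    using openin_topspace[of "K_topology X"] by simp
next
  case False
  have U_sub: "U \<subseteq> topspace X"
    using U(1) openin_subset by blast
  then obtain c where c: "c \<in> topspace X" "c \<notin> U"
    using False by blast
  show ?thesis
  proof (subst openin_subopen, intro ballI)
    fix u
    assume u: "u \<in> U"
    have uX: "u \<in> topspace X" "u \<noteq> c"
      using u U_sub c by auto
    obtain P Q where PQ: "arc_pair X u c P Q"
      using two_flimsy_arc_pair_exists[OF X uX(1) c(1) uX(2)] .
    \<comment> \<open>\<open>u\<close> is in the closure of both arcs, since an arc together with an end point is connected.\<close>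
    have meets: "U \<inter> R \<noteq> {}" if RS: "arc_pair X u c R S" for R S
    proof
      assume disj: "U \<inter> R = {}"
      have "connectedin X (insert u R)"
        using arc_pair_connectedin_insert[OF X RS] .
      then show False
        using connectedinD[of X "insert u R" U R] U(1) u disj RS by (auto simp: arc_pair_def)
    qed
    obtain p q where p: "p \<in> P" "p \<in> U" and q: "q \<in> Q" "q \<in> U"
      using meets[OF PQ] meets[OF arc_pair_swap[OF PQ]] by blast
    obtain A B where AB: "arc_pair X p q A B" "u \<in> A" "c \<in> B"
      using arc_pair_separates[OF X PQ p(1) q(1)] .
    have "connectedin X (topspace X - U)"
      using two_flimsy_connectedin_complement[OF X U(2)] u by blast
    then have "topspace X - U \<subseteq> A \<or> topspace X - U \<subseteq> B"
      using arc_pair_subset_cases[OF AB(1)] p q by blast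
    then have "A \<subseteq> U"
      using AB c by (auto simp: arc_pair_def)
    then show "\<exists>T. openin (K_topology X) T \<and> u \<in> T \<and> T \<subseteq> U"
      using openin_K_topology_arc[OF X AB(1)] AB(2) by blast
  qed
qed

section \<open>The compact 2-flimsy coarsening\<close>

theorem theorem1p4:
  fixes X :: "'a topology"
  assumes "two_flimsy X"
  shows "Hausdorff_space X \<and>
    (\<exists>!Y. coarser_topology Y X \<and> compact_space Y \<and> two_flimsy Y) \<and>
    coarser_topology (K_topology X) X \<and> compact_space (K_topology X) \<and>
    two_flimsy (K_topology X) \<and>
    (\<forall>S. connectedin X S \<longleftrightarrow> connectedin (K_topology X) S) \<and>
    (\<forall>U. openin X U \<and> connectedin X U \<longleftrightarrow>
         openin (K_topology X) U \<and> connectedin (K_topology X) U)"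
proof -
  have K: "coarser_topology (K_topology X) X" "compact_space (K_topology X)"
      "two_flimsy (K_topology X)"
    using assms coarser_K_topology compact_space_K_topology two_flimsy_K_topology by blast+
  have conn: "connectedin X S \<longleftrightarrow> connectedin (K_topology X) S" for S
    using coarser_topology_connectedin[OF K(1)] connectedin_K_topology_imp[OF assms] by blast
  have "openin X U \<and> connectedin X U \<longleftrightarrow>
      openin (K_topology X) U \<and> connectedin (K_topology X) U" for U
    using conn openin_connectedin_imp_openin_K_topology[OF assms] K(1)
    by (auto simp: coarser_topology_def)
  moreover have "\<exists>!Y. coarser_topology Y X \<and> compact_space Y \<and> two_flimsy Y"
    using K compact_two_flimsy_coarsening_unique[OF assms] by blast
  ultimately show ?thesis
    using two_flimsy_imp_Hausdorff_space[OF assms] K conn by blast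
qed

end
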